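(* Let $\delta>0$, let $\mu,\nu$ be two probability measures on $\mathbb{R}^d$ whose supports $\Omega:=\operatorname{Supp}(\mu)$ and $\Omega':=\operatorname{Supp}(\nu)$ are compact. Then there exists a transport plan $\gamma\in\Pi(\mu,\nu)$ minimizing the cost $\omega^K_\delta$ over $\Pi(\mu,\nu)$, i.e. $\omega^K_\delta(\gamma)\le\omega^K_\delta(\gamma')$ for all $\gamma'\in\Pi(\mu,\nu)$.
   Context: $\Pi(\mu,\nu):=\{\gamma\in\mathcal{P}(\Omega\times\Omega') : (\pi_1)_\#\gamma=\mu,\ (\pi_2)_\#\gamma=\nu\}$ is the set of transport plans from $\mu$ to $\nu$, where $\mathcal{P}$ denotes Borel probability measures and $\pi_1,\pi_2$ are the projections on the two factors. For $\gamma\in\Pi(\mu,\nu)$, $$\omega^K_\delta(\gamma):=(\gamma\otimes\gamma)\text{-}\operatorname{ess\,sup}\{|y-y'| : (x,y),(x',y')\in\Omega\times\Omega',\ |x-x'|<\delta\},$$ that is, $\omega^K_\delta(\gamma)=\|h\|_{L^\infty(\gamma\otimes\gamma)}$ with $h((x,y),(x',y'))=|y-y'|\,\mathbf{1}_{\{|x-x'|<\delta\}}$. *)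

theory Defs
  imports "HOL-Probability.Probability"
begin

definition msupport :: "'a::topological_space measure \<Rightarrow> 'a set" where
  "msupport M = {x. \<forall>U. open U \<longrightarrow> x \<in> U \<longrightarrow> emeasure M U > 0}"

(* A plan lives on the Borel sigma-algebra of the subspace Supp mu x Supp nu.  Its marginals are
   pushed forward into the ambient space, where mu and nu themselves live. *)
definition transport_plans ::
    "'a::topological_space measure \<Rightarrow> 'b::topological_space measure \<Rightarrow> ('a \<times> 'b) measure set" where
  "transport_plans \<mu> \<nu> =
     {\<gamma>. prob_space \<gamma> \<and> sets \<gamma> = sets (restrict_space borel (msupport \<mu> \<times> msupport \<nu>)) \<and>
          distr \<gamma> borel fst = \<mu> \<and> distr \<gamma> borel snd = \<nu>}"

definition omegaK_integrand ::
    "real \<Rightarrow> ('a::real_normed_vector \<times> 'b::real_normed_vector) \<times> ('a \<times> 'b) \<Rightarrow> ereal" where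
  "omegaK_integrand \<delta> = (\<lambda>((x, y), (x', y')). if norm (x - x') < \<delta> then ereal (norm (y - y')) else 0)"

definition omegaK ::
    "real \<Rightarrow> ('a::real_normed_vector \<times> 'b::real_normed_vector) measure \<Rightarrow> ereal" where
  "omegaK \<delta> \<gamma> = esssup (\<gamma> \<Otimes>\<^sub>M \<gamma>) (omegaK_integrand \<delta>)"

(* esssup takes the value top on non-measurable functions; that case does not occur for plans. *)
lemma omegaK_integrand_measurable:
  fixes \<mu> :: "'a::euclidean_space measure" and \<nu> :: "'b::euclidean_space measure"
  assumes "\<gamma> \<in> transport_plans \<mu> \<nu>"
  shows "omegaK_integrand \<delta> \<in> borel_measurable (\<gamma> \<Otimes>\<^sub>M \<gamma>)"
proof -
  have sets: "sets \<gamma> = sets (restrict_space borel (msupport \<mu> \<times> msupport \<nu>))"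
    using assms by (simp add: transport_plans_def)
  have "(\<lambda>p. p) \<in> \<gamma> \<rightarrow>\<^sub>M borel"
    unfolding measurable_cong_sets[OF sets refl] by (simp add: measurable_restrict_space1)
  then have [measurable]: "fst \<in> borel_measurable \<gamma>" "snd \<in> borel_measurable \<gamma>"
    unfolding borel_prod[symmetric]
    by (auto dest: measurable_compose[OF _ measurable_fst] measurable_compose[OF _ measurable_snd])
  show ?thesis
    unfolding omegaK_integrand_def case_prod_beta by measurable
qed

end

theory Submission
  imports Defs
begin

text \<open>
  Instead of weak convergence of measures we use pointwise convergence of set functions. The set
  functions \<open>W \<mapsto> \<gamma> (W \<inter> space \<gamma>)\<close> of plans lie in a cube \<open>[0, 1]\<^sup>I\<close>, which is compact by
  Tychonoff's theorem, so the nested closures of the sublevel sets of the cost have a common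
  point \<open>m\<close>. A priori \<open>m\<close> is only finitely additive, but its marginals are still \<open>\<mu>\<close> and \<open>\<nu>\<close>.
  Regularity of \<open>\<mu>\<close> and \<open>\<nu>\<close> makes \<open>m\<close> countably additive on rectangles, so by Caratheodory it
  agrees there with a plan \<open>\<gamma>\<close>.
  If the cost of \<open>\<gamma>\<close> exceeded \<open>a \<ge> 0\<close>, then, the set where the integrand exceeds \<open>a\<close> being open,
  there would be open rectangles \<open>R\<^sub>1\<close>, \<open>R\<^sub>2\<close> of positive measure with \<open>R\<^sub>1 \<times> R\<^sub>2\<close> inside that set;
  plans whose set functions are close to \<open>m\<close> at \<open>R\<^sub>1\<close> and \<open>R\<^sub>2\<close> would then also have cost above \<open>a\<close>.
\<close>

section \<open>Finitely additive couplings are countably additive on rectangles\<close>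

text \<open>Regularity is measured by the mass of the difference set, here and in the inner version:
  this is the error paid in a marginal when one side of a rectangle is replaced by an open or a
  compact set. Finiteness permits the subtraction.\<close>

lemma finite_borel_measure_outer_approx:
  fixes M :: "'a::{second_countable_topology, complete_space} measure"
  assumes "finite_measure M" "sets M = sets borel" "B \<in> sets borel" "e > 0"
  obtains U where "open U" "B \<subseteq> U" "emeasure M (U - B) \<le> ennreal e"
proof -
  interpret finite_measure M by fact
  have "emeasure M B < emeasure M B + ennreal e"
    using \<open>e > 0\<close> by (simp add: ennreal_less_top less_top)
  then have "(INF U \<in> {U. B \<subseteq> U \<and> open U}. emeasure M U) < emeasure M B + ennreal e"
    using outer_regular[of M B] assms by simp
  then obtain U where U: "B \<subseteq> U" "open U" "emeasure M U < emeasure M B + ennreal e"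
    by (auto simp: INF_less_iff)
  have "emeasure M (U - B) = emeasure M U - emeasure M B"
    using U assms by (intro emeasure_Diff) auto
  also have "\<dots> \<le> ennreal e"
    using U(3) by (simp add: ennreal_minus_le_iff less_imp_le)
  finally show ?thesis using U that by blast
qed

lemma finite_borel_measure_inner_approx:
  fixes M :: "'a::{second_countable_topology, complete_space} measure"
  assumes "finite_measure M" "sets M = sets borel" "B \<in> sets borel" "e > 0"
  obtains K where "compact K" "K \<subseteq> B" "emeasure M (B - K) \<le> ennreal e"
\<comment> \<open>Subtraction in \<open>ennreal\<close> is truncated, so
  \<open>emeasure M B - ennreal e\<close> lies strictly below \<open>emeasure M B\<close> only if
  the latter is positive.\<close>
proof (cases "emeasure M B = 0")
  case True
  then show ?thesis using that[of "{}"] by simp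
next
  case False
  interpret finite_measure M by fact
  have "0 < emeasure M B" "emeasure M B < top"
    using False emeasure_finite[of B] less_top by (blast intro: gr_zeroI)+
  then have "emeasure M B - ennreal e < emeasure M B"
    using \<open>e > 0\<close> by (intro ennreal_between) auto
  then have "emeasure M B - ennreal e < (SUP K \<in> {K. K \<subseteq> B \<and> compact K}. emeasure M K)"
    using inner_regular[of M B] assms by simp
  then obtain K where K: "K \<subseteq> B" "compact K" "emeasure M B - ennreal e < emeasure M K"
    by (auto simp: less_SUP_iff)
  have "emeasure M (B - K) = emeasure M B - emeasure M K"
    using K assms by (intro emeasure_Diff) (auto intro: borel_compact)
  also have "\<dots> \<le> ennreal e"
    using less_imp_le[OF K(3)] by (simp add: ennreal_minus_le_iff add.commute)
  finally show ?thesis using K that by blast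
qed

section \<open>Rectangles and the extension of set functions given on them\<close>

lemma borel_Times:
  fixes A :: "'a::second_countable_topology set" and B :: "'b::second_countable_topology set"
  assumes "A \<in> sets borel" "B \<in> sets borel"
  shows "A \<times> B \<in> sets borel"
  using assms unfolding borel_prod[symmetric] by (rule pair_measureI)

lemma semiring_of_sets_rectangles:
  "semiring_of_sets UNIV {A \<times> B | A B. A \<in> sets M \<and> B \<in> sets N}"
  (is "semiring_of_sets UNIV ?R")
proof
  have "{} = {} \<times> {}" "{} \<in> sets M" "{} \<in> sets N" by simp_all
  then show "{} \<in> ?R"
    unfolding mem_Collect_eq by metis
next
  fix X Y assume "X \<in> ?R" "Y \<in> ?R"
  then obtain A B C D where XY: "X = A \<times> B" "Y = C \<times> D"
    and sets: "A \<in> sets M" "B \<in> sets N" "C \<in> sets M" "D \<in> sets N" by blast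
  have "X \<inter> Y = (A \<inter> C) \<times> (B \<inter> D)" unfolding XY by auto
  then show "X \<inter> Y \<in> ?R" using sets by blast
  \<comment> \<open>A point of \<open>X - Y\<close> either has its first coordinate outside
    \<open>C\<close>, or has it in \<open>C\<close> and its second coordinate outside
    \<open>D\<close>; the two cases are disjoint rectangles.\<close>
  have "(A - C) \<times> B \<in> ?R" "(A \<inter> C) \<times> (B - D) \<in> ?R" using sets by blast+
  then show "\<exists>R\<subseteq>?R. finite R \<and> disjoint R \<and> X - Y = \<Union>R"
    unfolding XY by (intro exI[of _ "{(A - C) \<times> B, (A \<inter> C) \<times> (B - D)}"]) (auto simp: disjoint_def)
qed simp

text \<open>A compact rectangle almost filling the union is covered by slightly enlarged open
  rectangles, of which finitely many suffice; the marginals, being genuine measures, bound the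
  errors. Agreement is claimed on rectangles only: elsewhere a finitely additive \<open>f\<close>
  can differ from the measure, for instance on the diagonal.\<close>

lemma finitely_additive_coupling_extends:
  fixes \<mu> :: "'a::polish_space measure" and \<nu> :: "'b::polish_space measure"
    and f :: "('a \<times> 'b) set \<Rightarrow> ennreal"
  assumes \<mu>: "finite_measure \<mu>" "sets \<mu> = sets borel"
    and \<nu>: "finite_measure \<nu>" "sets \<nu> = sets borel"
    and pos: "positive (sets borel) f" and add: "additive (sets borel) f"
    and fst: "\<And>A. A \<in> sets borel \<Longrightarrow> f (A \<times> UNIV) = emeasure \<mu> A"
    and snd: "\<And>B. B \<in> sets borel \<Longrightarrow> f (UNIV \<times> B) = emeasure \<nu> B"
  obtains \<gamma> where "sets \<gamma> = sets borel"
    "\<And>A B. A \<in> sets borel \<Longrightarrow> B \<in> sets borel \<Longrightarrow> emeasure \<gamma> (A \<times> B) = f (A \<times> B)"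
proof -
  interpret B: ring_of_sets UNIV "sets (borel :: ('a \<times> 'b) measure)"
    using sets.ring_of_sets_axioms[of "borel :: ('a \<times> 'b) measure"] by simp
  define R where "R = {A \<times> B | A B. A \<in> sets (borel :: 'a measure) \<and> B \<in> sets (borel :: 'b measure)}"
  interpret R: semiring_of_sets UNIV R
    unfolding R_def by (rule semiring_of_sets_rectangles)
  have R_borel: "R \<subseteq> sets borel"
    by (auto simp: R_def borel_Times)
  have mono: "f X \<le> f Y" if "X \<subseteq> Y" "X \<in> sets borel" "Y \<in> sets borel" for X Y
    using B.additive_increasing[OF pos add] that by (auto simp: increasing_def)
  have subadd: "f (\<Union>i\<in>I. X i) \<le> (\<Sum>i\<in>I. f (X i))" if "finite I" "\<And>i. X i \<in> sets borel"
    for X and I :: "nat set"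
    using that by (intro B.subadditive[OF pos add]) auto
  have Un: "f (X \<union> Y) \<le> f X + f Y" if "X \<in> sets borel" "Y \<in> sets borel" for X Y
  proof -
    have "f (X \<union> Y) = f (X \<union> (Y - X))" by simp
    also have "\<dots> = f X + f (Y - X)"
      using that by (intro add[unfolded additive_def, rule_format]) auto
    also have "\<dots> \<le> f X + f Y"
      using that by (intro add_left_mono mono) auto
    finally show ?thesis .
  qed
  \<comment> \<open>What is lost lies in two full strips, on which \<open>f\<close> is a marginal.
    This serves both for shrinking \<open>C \<times> D\<close> to a compact rectangle and for
    enlarging each \<open>X i\<close> to an open one.\<close>
  have enlarge: "f (A' \<times> B') \<le> f (A \<times> B) + (emeasure \<mu> (A' - A) + emeasure \<nu> (B' - B))"
    if "A \<in> sets borel" "B \<in> sets borel" "A' \<in> sets borel" "B' \<in> sets borel" for A A' B B'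
  proof -
    have "f (A' \<times> B') \<le> f (A \<times> B \<union> ((A' - A) \<times> UNIV \<union> UNIV \<times> (B' - B)))"
      using that by (intro mono) (auto intro!: borel_Times sets.Un)
    also have "\<dots> \<le> f (A \<times> B) + f ((A' - A) \<times> UNIV \<union> UNIV \<times> (B' - B))"
      using that by (intro Un) (auto intro!: borel_Times sets.Un)
    also have "\<dots> \<le> f (A \<times> B) + (f ((A' - A) \<times> UNIV) + f (UNIV \<times> (B' - B)))"
      using that by (intro add_left_mono Un) (auto intro!: borel_Times)
    finally show ?thesis using that by (simp add: fst snd)
  qed
  have "countably_additive R f"
  proof (rule countably_additiveI)
    fix X :: "nat \<Rightarrow> ('a \<times> 'b) set"
    assume X: "range X \<subseteq> R" "disjoint_family X" "(\<Union>i. X i) \<in> R"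
    have X_borel: "X i \<in> sets borel" for i using X R_borel by auto
    have "\<forall>i. \<exists>A B. X i = A \<times> B \<and> A \<in> sets borel \<and> B \<in> sets borel"
      using X(1) unfolding R_def by blast
    then obtain A B where AB: "\<And>i. X i = A i \<times> B i"
      "\<And>i. A i \<in> sets borel" "\<And>i. B i \<in> sets borel" by metis
    from X(3) obtain C D where CD: "(\<Union>i. X i) = C \<times> D" "C \<in> sets borel" "D \<in> sets borel"
      unfolding R_def by auto
    \<comment> \<open>This direction needs only finite additivity and monotonicity; regularity
      enters in the reverse one.\<close>
    have "(\<Sum>i. f (X i)) \<le> f (\<Union>i. X i)"
    proof (rule suminf_le_const)
      fix n
      have "(\<Sum>i<n. f (X i)) = f (\<Union>i<n. X i)"
        using X X_borel
        by (intro B.additive_sum[OF pos add]) (auto intro: disjoint_family_on_mono)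
      also have "\<dots> \<le> f (\<Union>i. X i)"
        using X_borel by (intro mono) auto
      finally show "(\<Sum>i<n. f (X i)) \<le> f (\<Union>i. X i)" .
    qed simp
    moreover have "f (\<Union>i. X i) \<le> (\<Sum>i. f (X i))"
    proof (rule ennreal_le_epsilon)
      fix e :: real assume "0 < e"
      \<comment> \<open>The error of moving a rectangle is controlled by the marginals alone, see \<open>enlarge\<close>.\<close>
      define d where "d i = (e / 4) * (1/2) ^ Suc i" for i :: nat
      have d: "d i > 0" for i using \<open>0 < e\<close> by (simp add: d_def)
      have d_sums: "d sums (e / 4)"
        using sums_mult[OF power_half_series, of "e / 4"] by (simp add: d_def[abs_def])
      have "\<forall>i. \<exists>U. open U \<and> A i \<subseteq> U \<and> emeasure \<mu> (U - A i) \<le> ennreal (d i)"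
        using finite_borel_measure_outer_approx[OF \<mu> AB(2) d] by metis
      then obtain U where U: "\<And>i. open (U i)" "\<And>i. A i \<subseteq> U i"
        "\<And>i. emeasure \<mu> (U i - A i) \<le> ennreal (d i)" by metis
      have "\<forall>i. \<exists>V. open V \<and> B i \<subseteq> V \<and> emeasure \<nu> (V - B i) \<le> ennreal (d i)"
        using finite_borel_measure_outer_approx[OF \<nu> AB(3) d] by metis
      then obtain V where V: "\<And>i. open (V i)" "\<And>i. B i \<subseteq> V i"
        "\<And>i. emeasure \<nu> (V i - B i) \<le> ennreal (d i)" by metis
      \<comment> \<open>The error \<open>e\<close> is spent in quarters: one each for
        \<open>K\<close> and \<open>L\<close>, and one each for all \<open>U i\<close> together and
        all \<open>V i\<close> together, as \<open>d\<close> sums to \<open>e / 4\<close>.\<close>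
      obtain K where K: "compact K" "K \<subseteq> C" "emeasure \<mu> (C - K) \<le> ennreal (e / 4)"
        using finite_borel_measure_inner_approx[OF \<mu> CD(2), of "e / 4"] \<open>0 < e\<close> by auto
      obtain L where L: "compact L" "L \<subseteq> D" "emeasure \<nu> (D - L) \<le> ennreal (e / 4)"
        using finite_borel_measure_inner_approx[OF \<nu> CD(3), of "e / 4"] \<open>0 < e\<close> by auto
      have "K \<times> L \<subseteq> (\<Union>i. U i \<times> V i)"
      proof -
        have "K \<times> L \<subseteq> (\<Union>i. X i)" using K L CD by auto
        also have "\<dots> \<subseteq> (\<Union>i. U i \<times> V i)" unfolding AB(1) by (intro UN_mono Sigma_mono U V subset_refl)
        finally show ?thesis .
      qed
      moreover have "open (U i \<times> V i)" for i
        using U V by (intro open_Times)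
      \<comment> \<open>Passing to a finite subcover makes finite subadditivity of \<open>f\<close>
        sufficient.\<close>
      ultimately obtain I where I: "finite I" "K \<times> L \<subseteq> (\<Union>i\<in>I. U i \<times> V i)"
        using compactE_image[OF compact_Times[OF K(1) L(1)], of UNIV "\<lambda>i. U i \<times> V i"] by metis
      have UV: "U i \<times> V i \<in> sets borel" for i
        using U V by (intro borel_open open_Times)
      have "f (C \<times> D) \<le> f (K \<times> L) + (emeasure \<mu> (C - K) + emeasure \<nu> (D - L))"
        using K L CD by (intro enlarge) (auto intro: borel_compact)
      also have "\<dots> \<le> f (K \<times> L) + (ennreal (e/4) + ennreal (e/4))"
        by (intro add_mono K L) simp
      also have "f (K \<times> L) \<le> f (\<Union>i\<in>I. U i \<times> V i)"
        using I UV K L by (intro mono borel_Times) (auto intro: borel_compact sets.finite_UN)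
      also have "\<dots> \<le> (\<Sum>i\<in>I. f (U i \<times> V i))"
        by (intro subadd I UV)
      also have "\<dots> \<le> (\<Sum>i. f (U i \<times> V i))"
        using I by (intro sum_le_suminf) auto
      also have "\<dots> \<le> (\<Sum>i. f (X i) + (ennreal (d i) + ennreal (d i)))"
      proof (intro suminf_le)
        fix i
        have "f (U i \<times> V i) \<le> f (X i) + (emeasure \<mu> (U i - A i) + emeasure \<nu> (V i - B i))"
          unfolding AB(1) using U V AB by (intro enlarge) auto
        also have "\<dots> \<le> f (X i) + (ennreal (d i) + ennreal (d i))"
          by (intro add_left_mono add_mono U V)
        finally show "f (U i \<times> V i) \<le> f (X i) + (ennreal (d i) + ennreal (d i))" .
      qed auto
      also have "\<dots> = (\<Sum>i. f (X i)) + ((\<Sum>i. ennreal (d i)) + (\<Sum>i. ennreal (d i)))"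
        by (simp add: suminf_add[symmetric])
      also have "(\<Sum>i. ennreal (d i)) = ennreal (e / 4)"
        using d_sums d by (subst suminf_ennreal2) (auto simp: sums_iff less_imp_le)
      finally have "f (C \<times> D) \<le> (\<Sum>i. f (X i)) + (ennreal (e/4) + ennreal (e/4)) + (ennreal (e/4) + ennreal (e/4))"
        by (auto simp: add_right_mono)
      also have "\<dots> = (\<Sum>i. f (X i)) + ennreal e"
        using \<open>0 < e\<close> by (simp add: add.assoc flip: ennreal_plus)
      finally show "f (\<Union>i. X i) \<le> (\<Sum>i. f (X i)) + ennreal e"
        using CD by simp
    qed
    ultimately show "(\<Sum>i. f (X i)) = f (\<Union>i. X i)" by simp
  qed
  moreover have "positive R f" using pos by (simp add: positive_def)
  ultimately obtain \<gamma>0 where \<gamma>0: "\<forall>s\<in>R. \<gamma>0 s = f s" "measure_space UNIV (sigma_sets UNIV R) \<gamma>0"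
    using R.caratheodory[of f] by blast
  have sig: "sigma_sets UNIV R = sets borel"
    unfolding borel_prod[symmetric] sets_pair_measure R_def by simp
  define \<gamma> where "\<gamma> = measure_of UNIV R \<gamma>0"
  have sets: "sets \<gamma> = sets borel"
    unfolding \<gamma>_def by (simp add: sig)
  moreover have "emeasure \<gamma> (A \<times> B) = f (A \<times> B)" if "A \<in> sets borel" "B \<in> sets borel" for A B
  proof -
    have "A \<times> B \<in> R" using that by (auto simp: R_def)
    moreover have "emeasure \<gamma> (A \<times> B) = \<gamma>0 (A \<times> B)"
      using \<gamma>0(2) that sets borel_Times[OF that]
      by (intro emeasure_measure_of[OF \<gamma>_def]) (auto simp: measure_space_def sig)
    ultimately show ?thesis using \<gamma>0 by simp
  qed
  ultimately show ?thesis using that by blast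
qed

section \<open>Supports and transport plans\<close>

lemma closed_msupport: "closed (msupport M)"
proof -
  have "- msupport M = \<Union>{U. open U \<and> emeasure M U = 0}"
    by (auto simp: msupport_def)
  then show ?thesis by (auto simp: closed_def)
qed

text \<open>The complement is the union of all open null sets, and by Lindelof countably many of
  them already cover it.\<close>

lemma emeasure_compl_msupport:
  fixes M :: "'a::second_countable_topology measure"
  assumes "sets M = sets borel"
  shows "emeasure M (- msupport M) = 0"
proof -
  obtain F where F: "F \<subseteq> {U. open U \<and> emeasure M U = 0}" "countable F"
    "\<Union>F = \<Union>{U. open U \<and> emeasure M U = 0}"
    using Lindelof[of "{U. open U \<and> emeasure M U = 0}"] by auto
  have "- msupport M = \<Union>F"
    unfolding F(3) by (auto simp: msupport_def)
  moreover have "(\<Union>U\<in>F. U) \<in> null_sets M"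
    using F assms by (intro null_sets_UN') (auto intro!: null_setsI dest!: subsetD)
  ultimately show ?thesis by auto
qed

section \<open>Plans as couplings restricted to the product of the supports\<close>

lemma measurable_fst_snd_restrict_borel:
  fixes \<gamma> :: "('a::second_countable_topology \<times> 'b::second_countable_topology) measure"
  assumes sets: "sets \<gamma> = sets (restrict_space borel S)"
  shows "fst \<in> borel_measurable \<gamma>" "snd \<in> borel_measurable \<gamma>"
proof -
  have "(\<lambda>p. p) \<in> \<gamma> \<rightarrow>\<^sub>M borel"
    unfolding measurable_cong_sets[OF sets refl] by (simp add: measurable_restrict_space1)
  then show "fst \<in> borel_measurable \<gamma>" "snd \<in> borel_measurable \<gamma>"
    unfolding borel_prod[symmetric]
    by (auto dest: measurable_compose[OF _ measurable_fst] measurable_compose[OF _ measurable_snd])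
qed

text \<open>Plans live on a subspace, whereas limits are taken over sets of the ambient product;
  intersecting with \<open>space \<gamma>\<close> passes between the two.\<close>

lemma transport_plansD:
  fixes \<mu> :: "'a::second_countable_topology measure" and \<nu> :: "'b::second_countable_topology measure"
  assumes "\<gamma> \<in> transport_plans \<mu> \<nu>"
  shows "prob_space \<gamma>" "space \<gamma> = msupport \<mu> \<times> msupport \<nu>"
    "W \<in> sets borel \<Longrightarrow> W \<inter> space \<gamma> \<in> sets \<gamma>"
    "A \<in> sets borel \<Longrightarrow> emeasure \<gamma> (A \<times> UNIV \<inter> space \<gamma>) = emeasure \<mu> A"
    "B \<in> sets borel \<Longrightarrow> emeasure \<gamma> (UNIV \<times> B \<inter> space \<gamma>) = emeasure \<nu> B"
proof -
  have sets: "sets \<gamma> = sets (restrict_space borel (msupport \<mu> \<times> msupport \<nu>))"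
    using assms by (simp add: transport_plans_def)
  show "prob_space \<gamma>" using assms by (simp add: transport_plans_def)
  show sp: "space \<gamma> = msupport \<mu> \<times> msupport \<nu>"
    using sets_eq_imp_space_eq[OF sets] by (simp add: space_restrict_space)
  show "W \<in> sets borel \<Longrightarrow> W \<inter> space \<gamma> \<in> sets \<gamma>"
    unfolding sets sp by (auto simp: sets_restrict_space)
  note m = measurable_fst_snd_restrict_borel[OF sets]
  have d: "distr \<gamma> borel fst = \<mu>" "distr \<gamma> borel snd = \<nu>"
    using assms by (auto simp: transport_plans_def)
  show "A \<in> sets borel \<Longrightarrow> emeasure \<gamma> (A \<times> UNIV \<inter> space \<gamma>) = emeasure \<mu> A"
    by (subst d(1)[symmetric]) (simp add: emeasure_distr m fst_vimage_eq_Times)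
  show "B \<in> sets borel \<Longrightarrow> emeasure \<gamma> (UNIV \<times> B \<inter> space \<gamma>) = emeasure \<nu> B"
    by (subst d(2)[symmetric]) (simp add: emeasure_distr m snd_vimage_eq_Times)
qed

text \<open>Outside the product of the supports there are only two strips over marginal null sets,
  so the restriction loses no mass.\<close>

lemma restrict_coupling_transport_plan:
  fixes \<mu> :: "'a::second_countable_topology measure" and \<nu> :: "'b::second_countable_topology measure"
  assumes \<mu>: "prob_space \<mu>" "sets \<mu> = sets borel"
    and \<nu>: "prob_space \<nu>" "sets \<nu> = sets borel"
    and \<Gamma>: "sets \<Gamma> = sets borel"
    and fst: "\<And>A. A \<in> sets borel \<Longrightarrow> emeasure \<Gamma> (A \<times> UNIV) = emeasure \<mu> A"
    and snd: "\<And>B. B \<in> sets borel \<Longrightarrow> emeasure \<Gamma> (UNIV \<times> B) = emeasure \<nu> B"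
  defines "\<gamma> \<equiv> restrict_space \<Gamma> (msupport \<mu> \<times> msupport \<nu>)"
  shows "\<gamma> \<in> transport_plans \<mu> \<nu>"
    and "W \<in> sets borel \<Longrightarrow> emeasure \<gamma> (W \<inter> space \<gamma>) = emeasure \<Gamma> W"
proof -
  define S where "S = msupport \<mu> \<times> msupport \<nu>"
  have S: "S \<in> sets borel"
    unfolding S_def by (intro borel_closed closed_Times closed_msupport)
  have [simp]: "space \<Gamma> = UNIV" using sets_eq_imp_space_eq[OF \<Gamma>] by simp
  have "- S = (- msupport \<mu>) \<times> UNIV \<union> UNIV \<times> (- msupport \<nu>)"
    by (auto simp: S_def)
  moreover have "(- msupport \<mu>) \<times> UNIV \<in> null_sets \<Gamma>"
    using closed_msupport[of \<mu>] \<mu>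
    by (intro null_setsI) (auto simp: fst emeasure_compl_msupport \<Gamma> intro!: borel_open open_Times)
  moreover have "UNIV \<times> (- msupport \<nu>) \<in> null_sets \<Gamma>"
    using closed_msupport[of \<nu>] \<nu>
    by (intro null_setsI) (auto simp: snd emeasure_compl_msupport \<Gamma> intro!: borel_open open_Times)
  ultimately have null: "- S \<in> null_sets \<Gamma>" by auto
  have sp: "space \<gamma> = S"
    unfolding \<gamma>_def S_def by (simp add: space_restrict_space)
  show em: "emeasure \<gamma> (W \<inter> space \<gamma>) = emeasure \<Gamma> W" if "W \<in> sets borel" for W
  proof -
    have "emeasure \<gamma> (W \<inter> S) = emeasure \<Gamma> (W \<inter> S)"
      unfolding \<gamma>_def S_def[symmetric] using S \<Gamma> by (intro emeasure_restrict_space) auto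
    also have "W \<inter> S = W - (- S)" by auto
    also have "emeasure \<Gamma> (W - (- S)) = emeasure \<Gamma> W"
      using that \<Gamma> by (intro emeasure_Diff_null_set null) auto
    finally show ?thesis by (simp add: sp)
  qed
  have sets: "sets \<gamma> = sets (restrict_space borel S)"
    unfolding \<gamma>_def S_def[symmetric] by (intro sets_restrict_space_cong \<Gamma>)
  note m = measurable_fst_snd_restrict_borel[OF sets]
  have "distr \<gamma> borel fst = \<mu>"
  proof (rule measure_eqI)
    fix A assume "A \<in> sets (distr \<gamma> borel fst)"
    then have A: "A \<in> sets borel" by simp
    then show "emeasure (distr \<gamma> borel fst) A = emeasure \<mu> A"
      using em[OF borel_Times, of A UNIV] by (simp add: emeasure_distr m fst_vimage_eq_Times fst)
  qed (simp add: \<mu>)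
  moreover have "distr \<gamma> borel snd = \<nu>"
  proof (rule measure_eqI)
    fix A assume "A \<in> sets (distr \<gamma> borel snd)"
    then have A: "A \<in> sets borel" by simp
    then show "emeasure (distr \<gamma> borel snd) A = emeasure \<nu> A"
      using em[OF borel_Times, of UNIV A] by (simp add: emeasure_distr m snd_vimage_eq_Times snd)
  qed (simp add: \<nu>)
  moreover have "prob_space \<gamma>"
  proof
    have "emeasure \<mu> UNIV = 1"
      using prob_space.emeasure_space_1[OF \<mu>(1)] sets_eq_imp_space_eq[OF \<mu>(2)] by simp
    then show "emeasure \<gamma> (space \<gamma>) = 1"
      using em[of UNIV] fst[of UNIV] by simp
  qed
  ultimately show "\<gamma> \<in> transport_plans \<mu> \<nu>"
    using sets by (simp add: transport_plans_def S_def)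
qed

lemma transport_plans_nonempty:
  fixes \<mu> :: "'a::second_countable_topology measure" and \<nu> :: "'b::second_countable_topology measure"
  assumes \<mu>: "prob_space \<mu>" "sets \<mu> = sets borel"
    and \<nu>: "prob_space \<nu>" "sets \<nu> = sets borel"
  shows "transport_plans \<mu> \<nu> \<noteq> {}"
proof -
  interpret \<mu>: prob_space \<mu> by fact
  interpret \<nu>: prob_space \<nu> by fact
  have "space \<mu> = UNIV" "space \<nu> = UNIV"
    using \<mu> \<nu> by (auto dest: sets_eq_imp_space_eq)
  then have "emeasure \<mu> UNIV = 1" "emeasure \<nu> UNIV = 1"
    using \<mu>.emeasure_space_1 \<nu>.emeasure_space_1 by auto
  moreover have "sets (\<mu> \<Otimes>\<^sub>M \<nu>) = sets borel"
    unfolding borel_prod[symmetric] using \<mu> \<nu> by (intro sets_pair_measure_cong)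
  ultimately have "restrict_space (\<mu> \<Otimes>\<^sub>M \<nu>) (msupport \<mu> \<times> msupport \<nu>) \<in> transport_plans \<mu> \<nu>"
    using \<mu> \<nu> by (intro restrict_coupling_transport_plan) (auto simp: \<nu>.emeasure_pair_measure_Times)
  then show ?thesis by auto
qed

section \<open>The cost in terms of open rectangles\<close>

text \<open>The integrand dominates the constant 0, whose essential supremum is 0 because the
  product measure has nonzero mass. Hence the cost of any plan is an admissible level
  \<open>a\<close> in \<open>omegaK_leI\<close>.\<close>

lemma omegaK_nonneg:
  fixes \<mu> :: "'a::euclidean_space measure" and \<nu> :: "'b::euclidean_space measure"
  assumes \<gamma>: "\<gamma> \<in> transport_plans \<mu> \<nu>"
  shows "omegaK \<delta> \<gamma> \<ge> 0"
proof -
  interpret prob_space \<gamma> using transport_plansD(1)[OF \<gamma>] .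
  interpret P: pair_prob_space \<gamma> \<gamma> ..
  have "0 = esssup (\<gamma> \<Otimes>\<^sub>M \<gamma>) (\<lambda>_. 0 :: ereal)"
    using P.emeasure_space_1 by (simp add: esssup_const)
  also have "\<dots> \<le> omegaK \<delta> \<gamma>"
    unfolding omegaK_def by (intro esssup_mono) (auto simp: omegaK_integrand_def)
  finally show ?thesis .
qed

text \<open>The integrand exceeds its essential supremum only on a null set, and the product measure
  of \<open>W1 \<times> W2\<close> factorizes, so one factor must vanish.\<close>

lemma omegaK_le_imp_null:
  fixes \<mu> :: "'a::euclidean_space measure" and \<nu> :: "'b::euclidean_space measure"
  assumes \<gamma>: "\<gamma> \<in> transport_plans \<mu> \<nu>" and le: "omegaK \<delta> \<gamma> \<le> a"
    and W: "W1 \<in> sets borel" "W2 \<in> sets borel" "W1 \<times> W2 \<subseteq> {p. omegaK_integrand \<delta> p > a}"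
  shows "emeasure \<gamma> (W1 \<inter> space \<gamma>) = 0 \<or> emeasure \<gamma> (W2 \<inter> space \<gamma>) = 0"
proof -
  interpret prob_space \<gamma> using transport_plansD(1)[OF \<gamma>] .
  let ?W = "(W1 \<inter> space \<gamma>) \<times> (W2 \<inter> space \<gamma>)"
  have sets: "W1 \<inter> space \<gamma> \<in> sets \<gamma>" "W2 \<inter> space \<gamma> \<in> sets \<gamma>"
    using W transport_plansD(3)[OF \<gamma>] by auto
  have "AE p in \<gamma> \<Otimes>\<^sub>M \<gamma>. omegaK_integrand \<delta> p \<le> omegaK \<delta> \<gamma>"
    unfolding omegaK_def by (rule esssup_AE)
  then have "AE p in \<gamma> \<Otimes>\<^sub>M \<gamma>. p \<notin> ?W"
    by eventually_elim (use W(3) le in \<open>force simp: subset_iff not_less[symmetric]\<close>)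
  then have "?W \<in> null_sets (\<gamma> \<Otimes>\<^sub>M \<gamma>)"
    using sets by (subst AE_iff_null_sets) auto
  then have "emeasure (\<gamma> \<Otimes>\<^sub>M \<gamma>) ?W = 0" by auto
  then show ?thesis
    using sets by (simp add: emeasure_pair_measure_Times)
qed

text \<open>For \<open>a \<ge> 0\<close> the default value 0 is never above \<open>a\<close>, so
  what remains is two strict inequalities between continuous functions. The strict inequality in
  \<open>norm (x - x') < \<delta>\<close> is what makes the first one open.\<close>

lemma open_omegaK_integrand_greater:
  fixes a :: ereal
  assumes "a \<ge> 0"
  shows "open {p :: ('a::real_normed_vector \<times> 'b::real_normed_vector) \<times> ('a \<times> 'b). omegaK_integrand \<delta> p > a}"
proof -
  have "{p :: ('a \<times> 'b) \<times> ('a \<times> 'b). omegaK_integrand \<delta> p > a} =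
     {p. norm (fst (fst p) - fst (snd p)) < \<delta>} \<inter> {p. a < ereal (norm (snd (fst p) - snd (snd p)))}"
    using assms by (auto simp: omegaK_integrand_def split: if_splits)
  moreover have "open {p :: ('a \<times> 'b) \<times> ('a \<times> 'b). norm (fst (fst p) - fst (snd p)) < \<delta>}"
    by (intro open_Collect_less continuous_intros)
  moreover have "open {p :: ('a \<times> 'b) \<times> ('a \<times> 'b). a < ereal (norm (snd (fst p) - snd (snd p)))}"
    by (intro open_Collect_less continuous_intros)
  ultimately show ?thesis by (simp add: open_Int)
qed

text \<open>A converse to \<open>omegaK_le_imp_null\<close> that tests open rectangles only, the
  sets on which a limit of plans is controlled. By Lindelof countably many products of such
  rectangles cover the open superlevel set, which is therefore null.\<close>

lemma omegaK_leI:
  fixes \<mu> :: "'a::euclidean_space measure" and \<nu> :: "'b::euclidean_space measure"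
  assumes \<gamma>: "\<gamma> \<in> transport_plans \<mu> \<nu>" and "a \<ge> 0"
    and null: "\<And>U1 V1 U2 V2. \<lbrakk>open U1; open V1; open U2; open V2;
      (U1 \<times> V1) \<times> (U2 \<times> V2) \<subseteq> {p. omegaK_integrand \<delta> p > a}\<rbrakk> \<Longrightarrow>
      emeasure \<gamma> (U1 \<times> V1 \<inter> space \<gamma>) = 0 \<or> emeasure \<gamma> (U2 \<times> V2 \<inter> space \<gamma>) = 0"
  shows "omegaK \<delta> \<gamma> \<le> a"
proof -
  interpret prob_space \<gamma> using transport_plansD(1)[OF \<gamma>] .
  let ?O = "{p. omegaK_integrand \<delta> p > a} :: (('a \<times> 'b) \<times> ('a \<times> 'b)) set"
  define \<R> where "\<R> = {(U1 \<times> V1) \<times> (U2 \<times> V2) | U1 V1 U2 V2.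
    open U1 \<and> open V1 \<and> open U2 \<and> open V2 \<and> (U1 \<times> V1) \<times> (U2 \<times> V2) \<subseteq> ?O}"
  have cover: "?O \<subseteq> \<Union>\<R>"
  proof
    fix p assume p: "p \<in> ?O"
    obtain W1 W2 where W: "open W1" "open W2" "p \<in> W1 \<times> W2" "W1 \<times> W2 \<subseteq> ?O"
      using open_prod_elim[OF open_omegaK_integrand_greater[OF \<open>a \<ge> 0\<close>] p] by metis
    \<comment> \<open>The first splitting separates the two copies of the plan; each copy is now
      split again into its two coordinates.\<close>
    obtain U1 V1 where 1: "open U1" "open V1" "fst p \<in> U1 \<times> V1" "U1 \<times> V1 \<subseteq> W1"
      using open_prod_elim[OF W(1), of "fst p"] W(3) by (metis mem_Times_iff)
    obtain U2 V2 where 2: "open U2" "open V2" "snd p \<in> U2 \<times> V2" "U2 \<times> V2 \<subseteq> W2"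
      using open_prod_elim[OF W(2), of "snd p"] W(3) by (metis mem_Times_iff)
    have "(U1 \<times> V1) \<times> (U2 \<times> V2) \<subseteq> ?O"
      using 1(4) 2(4) W(4) by blast
    then have "(U1 \<times> V1) \<times> (U2 \<times> V2) \<in> \<R>"
      unfolding \<R>_def using 1 2 by blast
    moreover have "p \<in> (U1 \<times> V1) \<times> (U2 \<times> V2)" using 1(3) 2(3) by (simp add: mem_Times_iff)
    ultimately show "p \<in> \<Union>\<R>" by blast
  qed
  have "open R" if "R \<in> \<R>" for R
    using that by (auto simp: \<R>_def intro!: open_Times)
  then obtain \<R>' where \<R>': "\<R>' \<subseteq> \<R>" "countable \<R>'" "\<Union>\<R>' = \<Union>\<R>"
    using Lindelof[of \<R>] by blast
  let ?S = "space \<gamma> \<times> space \<gamma>"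
  have "(\<Union>R\<in>\<R>'. R \<inter> ?S) \<in> null_sets (\<gamma> \<Otimes>\<^sub>M \<gamma>)"
  proof (rule null_sets_UN'[OF \<R>'(2)])
    fix R assume "R \<in> \<R>'"
    then obtain U1 V1 U2 V2 where R: "R = (U1 \<times> V1) \<times> (U2 \<times> V2)"
      "open U1" "open V1" "open U2" "open V2" "(U1 \<times> V1) \<times> (U2 \<times> V2) \<subseteq> ?O"
      using \<R>'(1) by (auto simp: \<R>_def subset_iff)
    have eq: "R \<inter> ?S = (U1 \<times> V1 \<inter> space \<gamma>) \<times> (U2 \<times> V2 \<inter> space \<gamma>)"
      using R by auto
    have sets: "U1 \<times> V1 \<inter> space \<gamma> \<in> sets \<gamma>" "U2 \<times> V2 \<inter> space \<gamma> \<in> sets \<gamma>"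
      using R by (auto intro!: transport_plansD(3)[OF \<gamma>] borel_open open_Times)
    show "R \<inter> ?S \<in> null_sets (\<gamma> \<Otimes>\<^sub>M \<gamma>)"
      unfolding eq using sets null[OF R(2-6)]
      by (intro null_setsI) (auto simp: emeasure_pair_measure_Times)
  qed
  then have "AE p in \<gamma> \<Otimes>\<^sub>M \<gamma>. p \<notin> (\<Union>R\<in>\<R>'. R \<inter> ?S)"
    by (rule AE_not_in)
  then have "AE p in \<gamma> \<Otimes>\<^sub>M \<gamma>. omegaK_integrand \<delta> p \<le> a"
    using AE_space
  proof eventually_elim
    case (elim p)
    then have "p \<notin> \<Union>\<R>" unfolding \<R>'(3)[symmetric] by (auto simp: space_pair_measure)
    then show ?case using cover by (auto simp: not_less[symmetric])
  qed
  then show ?thesis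
    unfolding omegaK_def by (intro esssup_I omegaK_integrand_measurable[OF \<gamma>])
qed

section \<open>Compactness\<close>

lemma compact_unit_cube: "compact {m :: 'a \<Rightarrow> real. \<forall>x. m x \<in> {0..1}}"
proof -
  have "compactin (product_topology (\<lambda>_. euclideanreal) UNIV) (PiE UNIV (\<lambda>_::'a. {0..1::real}))"
    by (subst compactin_PiE) simp
  then show ?thesis
    by (simp add: euclidean_product_topology PiE_UNIV_domain Pi_def)
qed

text \<open>Passes closed conditions to limits, in particular equations and weak inequalities
  between finitely many coordinates.\<close>

lemma closure_closed_CollectD:
  assumes "m \<in> closure S" "closed {x. P x}" "\<And>x. x \<in> S \<Longrightarrow> P x"
  shows "P m"
  using closure_minimal[of S "{x. P x}"] assms by blast

text \<open>The intersection makes the function meaningful on ambient sets. Nonmeasurable sets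
  receive the default 0, so for a plan all coordinates lie in \<open>{0..1}\<close>.\<close>

definition plan_content :: "'a measure \<Rightarrow> 'a set \<Rightarrow> real" where
  "plan_content \<gamma> A = measure \<gamma> (A \<inter> space \<gamma>)"

text \<open>Nonnegativity, additivity and each marginal identity involve finitely many coordinates,
  so they survive in the closure. Countable additivity need not survive and is recovered on
  rectangles by \<open>finitely_additive_coupling_extends\<close>.\<close>

lemma closure_plan_content_extends:
  fixes \<mu> :: "'a::polish_space measure" and \<nu> :: "'b::polish_space measure"
  assumes \<mu>: "prob_space \<mu>" "sets \<mu> = sets borel"
    and \<nu>: "prob_space \<nu>" "sets \<nu> = sets borel"
    and m: "m \<in> closure (plan_content ` transport_plans \<mu> \<nu>)"
  obtains \<gamma> where "\<gamma> \<in> transport_plans \<mu> \<nu>"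
    "\<And>A B. A \<in> sets borel \<Longrightarrow> B \<in> sets borel \<Longrightarrow> emeasure \<gamma> (A \<times> B \<inter> space \<gamma>) = ennreal (m (A \<times> B))"
proof -
  interpret \<mu>: prob_space \<mu> by fact
  interpret \<nu>: prob_space \<nu> by fact
  note ci = closed_Collect_eq closed_Collect_le continuous_intros continuous_on_product_coordinates
  have nonneg: "m A \<ge> 0" for A
    by (rule closure_closed_CollectD[OF m]) (auto intro!: ci simp: plan_content_def)
  have empty: "m {} = 0"
    by (rule closure_closed_CollectD[OF m]) (auto intro!: ci simp: plan_content_def)
  have add: "m (A \<union> B) = m A + m B" if "A \<inter> B = {}" "A \<in> sets borel" "B \<in> sets borel" for A B
  proof (rule closure_closed_CollectD[OF m])
    show "closed {x. x (A \<union> B) = (x A + x B :: real)}"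
      by (intro ci)
    fix x assume "x \<in> plan_content ` transport_plans \<mu> \<nu>"
    then obtain \<gamma> where \<gamma>: "\<gamma> \<in> transport_plans \<mu> \<nu>" and x: "x = plan_content \<gamma>" by auto
    interpret prob_space \<gamma> using transport_plansD(1)[OF \<gamma>] .
    show "x (A \<union> B) = x A + x B"
      unfolding x plan_content_def Int_Un_distrib2 using that
      by (intro finite_measure_Union transport_plansD(3)[OF \<gamma>]) auto
  qed
  have fst: "m (A \<times> UNIV) = measure \<mu> A" if "A \<in> sets borel" for A
    by (rule closure_closed_CollectD[OF m])
      (auto intro!: ci simp: plan_content_def measure_def transport_plansD(4) that)
  have snd: "m (UNIV \<times> B) = measure \<nu> B" if "B \<in> sets borel" for B
    by (rule closure_closed_CollectD[OF m])
      (auto intro!: ci simp: plan_content_def measure_def transport_plansD(5) that)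
  obtain \<Gamma> where \<Gamma>: "sets \<Gamma> = sets borel"
    "\<And>A B. A \<in> sets borel \<Longrightarrow> B \<in> sets borel \<Longrightarrow> emeasure \<Gamma> (A \<times> B) = ennreal (m (A \<times> B))"
  proof (rule finitely_additive_coupling_extends[of \<mu> \<nu> "\<lambda>A. ennreal (m A)"])
    show "positive (sets borel) (\<lambda>A. ennreal (m A))"
      by (simp add: positive_def empty)
    show "additive (sets borel) (\<lambda>A. ennreal (m A))"
      by (auto simp: additive_def add nonneg)
  qed (use \<mu> \<nu> in \<open>auto simp: fst snd \<mu>.emeasure_eq_measure \<nu>.emeasure_eq_measure intro: prob_space.finite_measure\<close>)
  have f: "emeasure \<Gamma> (A \<times> UNIV) = emeasure \<mu> A" if "A \<in> sets borel" for A
    using that by (simp add: \<Gamma> fst \<mu>.emeasure_eq_measure)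
  have s: "emeasure \<Gamma> (UNIV \<times> B) = emeasure \<nu> B" if "B \<in> sets borel" for B
    using that by (simp add: \<Gamma> snd \<nu>.emeasure_eq_measure)
  show ?thesis
    using that[OF restrict_coupling_transport_plan(1)[OF \<mu> \<nu> \<Gamma>(1) f s]]
      restrict_coupling_transport_plan(2)[OF \<mu> \<nu> \<Gamma>(1) f s] \<Gamma>(2) borel_Times by metis
qed

theorem theorem1:
  fixes \<mu> \<nu> :: "(real ^ 'd) measure" and \<delta> :: real
  assumes "\<delta> > 0"
    and "prob_space \<mu>" and "sets \<mu> = sets borel"
    and "prob_space \<nu>" and "sets \<nu> = sets borel"
    and "compact (msupport \<mu>)" and "compact (msupport \<nu>)"
  shows "\<exists>\<gamma> \<in> transport_plans \<mu> \<nu>. \<forall>\<gamma>' \<in> transport_plans \<mu> \<nu>. omegaK \<delta> \<gamma> \<le> omegaK \<delta> \<gamma>'"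
proof -
  let ?P = "transport_plans \<mu> \<nu>"
  \<comment> \<open>The levels are the costs of the competitors themselves, so a common point of the
    closures has to be compared with each plan directly, without an infimum or a minimizing
    sequence.\<close>
  define S where "S \<gamma>' = plan_content ` {\<gamma> \<in> ?P. omegaK \<delta> \<gamma> \<le> omegaK \<delta> \<gamma>'}"
    for \<gamma>' :: "((real^'d) \<times> (real^'d)) measure"
  let ?K = "{m :: ((real^'d) \<times> (real^'d)) set \<Rightarrow> real. \<forall>x. m x \<in> {0..1}}"
  have "?K \<inter> (\<Inter>\<gamma>'\<in>?P. closure (S \<gamma>')) \<noteq> {}"
  proof (rule compact_imp_fip_image[OF compact_unit_cube])
    fix I assume I: "finite I" "I \<subseteq> ?P"
    \<comment> \<open>A cheapest plan of the finite set \<open>I\<close> lies in all its sublevel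
      sets; for empty \<open>I\<close> any plan will do.\<close>
    obtain \<gamma>0 where \<gamma>0: "\<gamma>0 \<in> ?P" "\<And>\<gamma>'. \<gamma>' \<in> I \<Longrightarrow> omegaK \<delta> \<gamma>0 \<le> omegaK \<delta> \<gamma>'"
    proof (cases "I = {}")
      case True
      then show ?thesis using that transport_plans_nonempty[OF assms(2-5)] by auto
    next
      case False
      have "arg_min_on (omegaK \<delta>) I \<in> I"
        using arg_min_if_finite(1)[OF I(1) False] .
      then show ?thesis
        using that[of "arg_min_on (omegaK \<delta>) I"] arg_min_least[OF I(1) False] I by blast
    qed
    have "plan_content \<gamma>0 \<in> S \<gamma>'" if "\<gamma>' \<in> I" for \<gamma>'
      using \<gamma>0 that by (auto simp: S_def)
    moreover have "plan_content \<gamma>0 \<in> ?K"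
      using prob_space.prob_le_1[OF transport_plansD(1)[OF \<gamma>0(1)]] by (simp add: plan_content_def)
    ultimately show "?K \<inter> (\<Inter>\<gamma>'\<in>I. closure (S \<gamma>')) \<noteq> {}"
      using closure_subset by blast
  qed auto
  then obtain m where m: "\<And>\<gamma>'. \<gamma>' \<in> ?P \<Longrightarrow> m \<in> closure (S \<gamma>')" by auto
  obtain \<gamma>1 where "\<gamma>1 \<in> ?P" using transport_plans_nonempty[OF assms(2-5)] by auto
  moreover have "S \<gamma>1 \<subseteq> plan_content ` ?P" by (auto simp: S_def)
  ultimately have "m \<in> closure (plan_content ` ?P)"
    using m closure_mono by blast
  then obtain \<gamma> where \<gamma>: "\<gamma> \<in> ?P"
    "\<And>A B. A \<in> sets borel \<Longrightarrow> B \<in> sets borel \<Longrightarrow> emeasure \<gamma> (A \<times> B \<inter> space \<gamma>) = ennreal (m (A \<times> B))"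
    using closure_plan_content_extends[OF assms(2-5)] by metis
  have "omegaK \<delta> \<gamma> \<le> omegaK \<delta> \<gamma>'" if \<gamma>': "\<gamma>' \<in> ?P" for \<gamma>'
  proof (rule omegaK_leI[OF \<gamma>(1) omegaK_nonneg[OF \<gamma>']], rule ccontr)
    fix U1 V1 U2 V2 :: "(real^'d) set"
    assume op: "open U1" "open V1" "open U2" "open V2"
      and sub: "(U1 \<times> V1) \<times> (U2 \<times> V2) \<subseteq> {p. omegaK_integrand \<delta> p > omegaK \<delta> \<gamma>'}"
      and "\<not> (emeasure \<gamma> (U1 \<times> V1 \<inter> space \<gamma>) = 0 \<or> emeasure \<gamma> (U2 \<times> V2 \<inter> space \<gamma>) = 0)"
    then have pos: "m (U1 \<times> V1) > 0" "m (U2 \<times> V2) > 0"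
      by (auto simp: \<gamma>(2) ennreal_eq_0_iff not_le)
    \<comment> \<open>Positivity at two coordinates is an open condition in the product topology. It
      holds at \<open>m\<close>, hence also for some plan in the sublevel set of
      \<open>\<gamma>'\<close>, whose cost bound then forces one of the two rectangles to be
      null.\<close>
    let ?O = "{x :: ((real^'d) \<times> (real^'d)) set \<Rightarrow> real. 0 < x (U1 \<times> V1)} \<inter> {x. 0 < x (U2 \<times> V2)}"
    have "open ?O"
      by (intro open_Int open_Collect_less continuous_on_const continuous_on_product_coordinates)
    moreover have "m \<in> ?O \<inter> closure (S \<gamma>')" using pos m[OF \<gamma>'] by auto
    ultimately have "?O \<inter> S \<gamma>' \<noteq> {}"
      using open_Int_closure_eq_empty[of ?O "S \<gamma>'"] by blast
    then obtain \<gamma>'' where \<gamma>'': "\<gamma>'' \<in> ?P" "omegaK \<delta> \<gamma>'' \<le> omegaK \<delta> \<gamma>'"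
      "plan_content \<gamma>'' (U1 \<times> V1) > 0" "plan_content \<gamma>'' (U2 \<times> V2) > 0"
      by (auto simp: S_def)
    have "emeasure \<gamma>'' (U1 \<times> V1 \<inter> space \<gamma>'') = 0 \<or> emeasure \<gamma>'' (U2 \<times> V2 \<inter> space \<gamma>'') = 0"
      using op sub by (intro omegaK_le_imp_null[OF \<gamma>''(1,2)]) (auto intro!: borel_open open_Times)
    then show False
      using \<gamma>''(3,4) by (auto simp: plan_content_def measure_def)
  qed
  then show ?thesis using \<gamma>(1) by blast
qed

end
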